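(* Let $m,n\in\mathbb{N}$, let $\sigma:\mathbb{R}\to\mathbb{R}$ be a Lipschitz continuous function that is differentiable almost everywhere with $\sigma'(\mathbb{R})\subset[\alpha,1]$ (at every point where $\sigma'$ exists) for some $0<\alpha\le 1$, and let $\delta\in\mathbb{R}$. Then the universal approximation property persists when the Lipschitz constant of the flow map is restricted to be at most $e^\delta$ (and the affine layers are unconstrained): the set of functions $$\{\ell_2\circ\phi\circ\ell_1 \ :\ d\in\mathbb{N},\ \ell_1\in\mathcal{A}(\mathbb{R}^m,\mathbb{R}^d),\ \phi\in\mathcal{F}_d \text{ with } \mathrm{Lip}(\phi)\le e^{\delta},\ \ell_2\in\mathcal{A}(\mathbb{R}^d,\mathbb{R}^n)\}$$ is a universal approximator for $\mathcal{C}(\mathbb{R}^m,\mathbb{R}^n)$ under the compact convergence topology.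
   Context: For $p,q\in\mathbb{N}$, $\mathcal{A}(\mathbb{R}^p,\mathbb{R}^q)$ denotes the set of all affine maps $x\mapsto Ax+b$ with $A\in\mathbb{R}^{q\times p}$, $b\in\mathbb{R}^q$. For $A\in\mathbb{R}^{d\times d}$ and $b\in\mathbb{R}^d$, $\phi_{A,b}:\mathbb{R}^d\to\mathbb{R}^d$ denotes the time-$1$ flow map of the autonomous ODE $\dot u(t)=\sigma(Au(t)+b)$, $t\in[0,1]$, where $\sigma$ is applied entrywise; that is, $\phi_{A,b}(u_0)=u(1)$, where $u$ is the solution with $u(0)=u_0$. Set $\mathcal{F}_d=\{\phi_{A,b} : A\in\mathbb{R}^{d\times d},\ b\in\mathbb{R}^d\}$. $\mathrm{Lip}(\phi)$ denotes the smallest Lipschitz constant of $\phi$ with respect to the Euclidean norm. $\mathcal{C}(\mathbb{R}^m,\mathbb{R}^n)$ is the space of continuous functions from $\mathbb{R}^m$ to $\mathbb{R}^n$. Let $\|\cdot\|$ be a norm on $\mathbb{R}^n$. A set $\mathcal{G}$ of functions from $\mathbb{R}^m$ to $\mathbb{R}^n$ is a universal approximator for $\mathcal{C}(\mathbb{R}^m,\mathbb{R}^n)$ under the compact convergence topology if for every $f\in\mathcal{C}(\mathbb{R}^m,\mathbb{R}^n)$, every compact $K\subset\mathbb{R}^m$ and every $\varepsilon>0$ there exists $\varphi\in\mathcal{G}$ with $\max_{x\in K}\|f(x)-\varphi(x)\|\le\varepsilon$.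
   Formalization: The formal theorem additionally assumes that σ is not affine; for affine σ (e.g. σ(x)=x, which meets all stated hypotheses) every flow map is affine, so all functions in the set are affine and the claim fails. *)

theory Defs
  imports "HOL-Analysis.Analysis"
begin

text \<open>
  The dimension d is bound inside the function class, so it cannot be a type.
  The space $R^n$ is therefore the carrier of the library topology
  \<open>Euclidean_space n\<close>: the functions \<open>nat \<Rightarrow> real\<close> that vanish at all indices
  \<open>i \<ge> n\<close>. Matrices are functions \<open>nat \<Rightarrow> nat \<Rightarrow> real\<close>, of which only the entries
  within bounds are used.
\<close>

abbreviation Rn :: "nat \<Rightarrow> (nat \<Rightarrow> real) set" where
  "Rn n \<equiv> topspace (Euclidean_space n)"

definition affine_map ::
  "nat \<Rightarrow> nat \<Rightarrow> (nat \<Rightarrow> nat \<Rightarrow> real) \<Rightarrow> (nat \<Rightarrow> real) \<Rightarrow> (nat \<Rightarrow> real) \<Rightarrow> (nat \<Rightarrow> real)" where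
  "affine_map p q A b x = (\<lambda>i. if i < q then (\<Sum>j<p. A i j * x j) + b i else 0)"

definition affine_maps :: "nat \<Rightarrow> nat \<Rightarrow> ((nat \<Rightarrow> real) \<Rightarrow> (nat \<Rightarrow> real)) set" where
  "affine_maps p q = {affine_map p q A b | A b. True}"

text \<open>The derivative is one-sided at the end points 0 and 1 of the time interval.\<close>

definition ode_solution ::
  "(real \<Rightarrow> real) \<Rightarrow> nat \<Rightarrow> (nat \<Rightarrow> nat \<Rightarrow> real) \<Rightarrow> (nat \<Rightarrow> real) \<Rightarrow> (nat \<Rightarrow> real)
    \<Rightarrow> (real \<Rightarrow> nat \<Rightarrow> real) \<Rightarrow> bool" where
  "ode_solution \<sigma> d A b u0 u \<longleftrightarrow>
     u 0 = u0 \<and>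
     (\<forall>t\<in>{0..1}. u t \<in> Rn d \<and>
        (\<forall>i<d. ((\<lambda>s. u s i) has_real_derivative \<sigma> (affine_map d d A b (u t) i)) (at t within {0..1})))"

text \<open>For Lipschitz continuous \<open>\<sigma>\<close> and \<open>u0 \<in> Rn d\<close> the value described here exists and is
  unique; off \<open>Rn d\<close> the map is unspecified.\<close>

definition flow_map ::
  "(real \<Rightarrow> real) \<Rightarrow> nat \<Rightarrow> (nat \<Rightarrow> nat \<Rightarrow> real) \<Rightarrow> (nat \<Rightarrow> real) \<Rightarrow> (nat \<Rightarrow> real) \<Rightarrow> (nat \<Rightarrow> real)" where
  "flow_map \<sigma> d A b u0 = (THE v. \<exists>u. ode_solution \<sigma> d A b u0 u \<and> v = u 1)"

definition flow_maps :: "(real \<Rightarrow> real) \<Rightarrow> nat \<Rightarrow> ((nat \<Rightarrow> real) \<Rightarrow> (nat \<Rightarrow> real)) set" where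
  "flow_maps \<sigma> d = {flow_map \<sigma> d A b | A b. True}"

text \<open>The smallest Lipschitz constant on \<open>Rn d\<close> for the Euclidean norm; it is infinite if there
  is none. The function type carries a different metric in the library, so its notion of
  Lipschitz continuity does not apply.\<close>

definition Lip :: "nat \<Rightarrow> ((nat \<Rightarrow> real) \<Rightarrow> (nat \<Rightarrow> real)) \<Rightarrow> ereal" where
  "Lip d \<phi> = (INF L \<in> {L::real. 0 \<le> L \<and>
      (\<forall>x\<in>Rn d. \<forall>y\<in>Rn d. L2_set (\<lambda>i. \<phi> x i - \<phi> y i) {..<d} \<le> L * L2_set (\<lambda>i. x i - y i) {..<d})}.
      ereal L)"

definition norm_on_Rn :: "nat \<Rightarrow> ((nat \<Rightarrow> real) \<Rightarrow> real) \<Rightarrow> bool" where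
  "norm_on_Rn n N \<longleftrightarrow>
     (\<forall>x\<in>Rn n. 0 \<le> N x \<and> (N x = 0 \<longleftrightarrow> x = (\<lambda>i. 0))) \<and>
     (\<forall>x\<in>Rn n. \<forall>c. N (\<lambda>i. c * x i) = \<bar>c\<bar> * N x) \<and>
     (\<forall>x\<in>Rn n. \<forall>y\<in>Rn n. N (\<lambda>i. x i + y i) \<le> N x + N y)"

definition universal_approximator ::
  "nat \<Rightarrow> nat \<Rightarrow> ((nat \<Rightarrow> real) \<Rightarrow> real) \<Rightarrow> ((nat \<Rightarrow> real) \<Rightarrow> (nat \<Rightarrow> real)) set \<Rightarrow> bool" where
  "universal_approximator m n N G \<longleftrightarrow>
     (\<forall>f K \<epsilon>. continuous_map (Euclidean_space m) (Euclidean_space n) f \<and>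
        compactin (Euclidean_space m) K \<and> 0 < \<epsilon> \<longrightarrow>
        (\<exists>\<phi>\<in>G. \<forall>x\<in>K. N (\<lambda>i. f x i - \<phi> x i) \<le> \<epsilon>))"

text \<open>If \<open>\<sigma>\<close> is affine, then so is every flow map, and this class consists of affine maps only.
  Hence it can be a universal approximator (for \<open>m\<close>, \<open>n\<close> positive) only if \<open>\<sigma>\<close> is not affine.\<close>

definition restricted_flow_nets ::
  "(real \<Rightarrow> real) \<Rightarrow> real \<Rightarrow> nat \<Rightarrow> nat \<Rightarrow> ((nat \<Rightarrow> real) \<Rightarrow> (nat \<Rightarrow> real)) set" where
  "restricted_flow_nets \<sigma> \<delta> m n =
     {l2 \<circ> \<phi> \<circ> l1 | d l1 \<phi> l2. 0 < d \<and> l1 \<in> affine_maps m d \<and>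
        \<phi> \<in> flow_maps \<sigma> d \<and> Lip d \<phi> \<le> ereal (exp \<delta>) \<and> l2 \<in> affine_maps d n}"

end

theory Submission
  imports Defs
begin

text \<open>
  For \<open>A = - \<mu> I\<close> and \<open>b = 0\<close> the flow acts on every coordinate as the time-one map \<open>g\<close> of
  \<open>u' = \<sigma> (- \<mu> u)\<close>, whose Lipschitz constant is at most \<open>exp (- \<alpha> \<mu>)\<close>, hence as small as
  desired. The networks with this flow are then the one-hidden-layer networks with activation \<open>g\<close>.

  Some large \<open>\<mu>\<close> makes \<open>g\<close> nonaffine: after rescaling, \<open>g\<close> is the time-\<open>\<mu>\<close> map of
  \<open>w' = - \<sigma> w\<close>, and if these maps were affine for all \<open>\<mu>\<close> in an interval, then so would be
  their derivative with respect to \<open>\<mu>\<close>, which is \<open>- \<sigma>\<close> composed with such a map.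

  For a Lipschitz nonaffine activation \<open>g\<close>, difference quotients in the weights of box averages of
  \<open>g (w \<bullet> x + b)\<close> converge to monomials in \<open>x\<close> times finite differences of \<open>g\<close>. No order of
  finite differences vanishes identically, so all polynomials are limits of networks.
\<close>

section \<open>Lipschitz functions with derivative bounded below\<close>

text \<open>If the mean slope were below \<open>c\<close>, subtracting a line of intermediate slope
  \<open>c'\<close> would give a function \<open>k\<close> with \<open>k b < k a\<close>. A
  Lipschitz map sends the null set of nondifferentiability to a null set, so some level strictly
  between \<open>k b\<close> and \<open>k a\<close> is attained only where \<open>f\<close> is
  differentiable. At the last point where \<open>k\<close> reaches this level its derivative is
  positive, so \<open>k\<close> stays above the level a little longer, which is absurd.\<close>

lemma lipschitz_AE_deriv_ge:
  fixes f :: "real \<Rightarrow> real"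
  assumes lip: "L-lipschitz_on UNIV f"
    and ae: "AE x in lebesgue. f differentiable (at x)"
    and deriv: "\<And>x. f differentiable (at x) \<Longrightarrow> c \<le> deriv f x"
    and "a \<le> b"
  shows "c * (b - a) \<le> f b - f a"
proof (rule ccontr)
  assume less: "\<not> ?thesis"
  with \<open>a \<le> b\<close> have "a < b"
    by (cases "a = b") auto
  with less have "(f b - f a) / (b - a) < c"
    by (simp add: field_simps)
  then obtain c' where c': "(f b - f a) / (b - a) < c'" "c' < c"
    using dense by blast
  define k where "k = (\<lambda>x. f x - c' * x)"
  define E where "E = {x. \<not> f differentiable (at x)}"
  have kba: "k b < k a"
    using c'(1) \<open>a < b\<close> by (simp add: k_def field_simps)
  have cont: "continuous_on S k" for S
    unfolding k_def
    using lipschitz_on_continuous_on[OF lip] continuous_on_subset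
    by (intro continuous_intros) blast
  obtain Z where "Z \<in> null_sets lebesgue" "E \<subseteq> Z"
    using ae unfolding eventually_ae_filter E_def by auto
  then have "negligible E"
    using negligible_iff_null_sets negligible_subset by blast
  then have "negligible (k ` E)"
  proof (rule negligible_locally_Lipschitz_image[rotated])
    fix x assume "x \<in> E"
    have "norm (k y - k x) \<le> (L + \<bar>c'\<bar>) * norm (y - x)" for y
    proof -
      have "\<bar>f y - f x\<bar> \<le> L * \<bar>y - x\<bar>"
        using lipschitz_onD[OF lip, of y x] by (simp add: dist_real_def)
      moreover have "\<bar>c' * y - c' * x\<bar> = \<bar>c'\<bar> * \<bar>y - x\<bar>"
        by (metis abs_mult right_diff_distrib)
      ultimately show ?thesis
        by (simp add: k_def algebra_simps)
    qed
    then show "\<exists>T B. open T \<and> x \<in> T \<and> (\<forall>y\<in>E \<inter> T. norm (k y - k x) \<le> B * norm (y - x))"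
      by (intro exI[of _ UNIV] exI[of _ "L + \<bar>c'\<bar>"]) auto
  qed simp
  moreover have "\<not> negligible {k b<..<k a}"
    using kba negligible_interval(2)[of "k b" "k a"] by (simp add: box_real)
  ultimately obtain y where y: "k b < y" "y < k a" "y \<notin> k ` E"
    using negligible_subset[of "k ` E" "{k b<..<k a}"] by force
  define S where "S = {x \<in> {a..b}. y \<le> k x}"
  have "S = {a..b} \<inter> k -` {y..}"
    by (auto simp: S_def)
  then have "compact S"
    using continuous_closed_preimage[OF cont, of "{a..b}" "{y..}"]
    by (simp add: compact_eq_bounded_closed bounded_Int)
  moreover have "a \<in> S"
    using y \<open>a < b\<close> by (simp add: S_def)
  ultimately obtain x where x: "x \<in> S" and x_max: "\<And>t. t \<in> S \<Longrightarrow> t \<le> x"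
    using compact_attains_sup[of S] by auto
  have "x < b"
    using x y by (cases "x = b") (auto simp: S_def)
  \<comment> \<open>The last point of the superlevel set lies on the level itself: the intermediate
    value theorem gives a point of level \<open>y\<close> at or to the right of \<open>x\<close>; it
    is again in \<open>S\<close>, hence equal to \<open>x\<close>.\<close>
  obtain x' where x': "x \<le> x'" "x' \<le> b" "k x' = y"
    using IVT2'[of k b y x] x y \<open>x < b\<close> cont by (auto simp: S_def)
  then have "x' \<in> S"
    using x by (simp add: S_def)
  then have "k x = y"
    using x_max x' by force
  then have "f differentiable (at x)"
    using y by (auto simp: E_def)
  then have "(k has_real_derivative deriv f x - c') (at x)"
    unfolding k_def
    by (auto intro!: derivative_eq_intros simp: DERIV_deriv_iff_real_differentiable)
  moreover have "0 < deriv f x - c'"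
    using deriv[OF \<open>f differentiable (at x)\<close>] c' by simp
  ultimately obtain d where "0 < d" and d: "\<And>h. 0 < h \<Longrightarrow> h < d \<Longrightarrow> k x < k (x + h)"
    using DERIV_pos_inc_right by blast
  define h where "h = min (d / 2) (b - x)"
  have h: "0 < h" "h < d" "x + h \<le> b"
    using \<open>0 < d\<close> \<open>x < b\<close> by (auto simp: h_def min_def)
  then have "x + h \<in> S"
    using d[of h] \<open>k x = y\<close> x by (auto simp: S_def)
  with x_max h show False
    by fastforce
qed

section \<open>Scalar autonomous differential equations\<close>

definition solves :: "(real \<Rightarrow> real) \<Rightarrow> real \<Rightarrow> (real \<Rightarrow> real) \<Rightarrow> bool" where
  "solves f T y \<longleftrightarrow> (\<forall>t\<in>{0..T}. (y has_real_derivative f (y t)) (at t within {0..T}))"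

text \<open>The global Lipschitz constant gives a solution on all of \<open>{0..T}\<close> by one
  application of the Banach fixed point theorem, without continuing local solutions.\<close>

lemma solves_exists:
  assumes lip: "L-lipschitz_on UNIV f" and "0 \<le> T"
  shows "\<exists>y. y 0 = y0 \<and> solves f T y"
proof -
  define M where "M = L + 1"
  have "0 < M"
    using lipschitz_on_nonneg[OF lip] by (simp add: M_def)
  have f_lip: "\<bar>f x - f y\<bar> \<le> M * \<bar>x - y\<bar>" for x y
    using lipschitz_onD[OF lip, of x y] mult_right_mono[of L M "\<bar>x - y\<bar>"]
    by (simp add: dist_real_def M_def)
  have f_cont: "continuous_on S f" for S
    using lipschitz_on_continuous_on[OF lip] continuous_on_subset by blast
  \<comment> \<open>In the unknown \<open>z t = exp (- 2 M t) * y t\<close> the Picard operator contracts on the whole interval.\<close>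
  define h where "h z \<tau> = exp (- 2 * M * \<tau>) * (y0 + integral {0..\<tau>} (\<lambda>s. f (exp (2 * M * s) * z s)))"
    for z :: "real \<Rightarrow> real" and \<tau>
  \<comment> \<open>The fixed point is sought among bounded continuous functions on the whole line.
    Clamping the time to \<open>{0..T}\<close> makes the image of the Picard operator such a
    function.\<close>
  define c where "c t = max 0 (min T t)" for t
  have c: "c t \<in> {0..T}" for t
    using \<open>0 \<le> T\<close> by (auto simp: c_def)
  have f_int: "continuous_on S (\<lambda>s. f (exp (2 * M * s) * z s))" if "continuous_on UNIV z" for z S
    by (rule continuous_on_compose2[OF f_cont[of UNIV]])
      (auto intro!: continuous_intros continuous_on_subset[OF that])
  have integrable: "(\<lambda>s. f (exp (2 * M * s) * z s)) integrable_on {0..\<tau>}" if "continuous_on UNIV z" for z \<tau>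
    by (rule integrable_continuous_real[OF f_int[OF that]])
  have h_cont: "continuous_on {0..T} (h z)" if "continuous_on UNIV z" for z
    unfolding h_def
    by (intro continuous_intros indefinite_integral_continuous_1 integrable that)
  have h_bcont: "(\<lambda>t. h z (c t)) \<in> bcontfun" if "continuous_on UNIV z" for z
  proof -
    have "continuous_on UNIV (\<lambda>t. h z (c t))"
      by (rule continuous_on_compose2[OF h_cont[OF that]])
        (use c in \<open>auto simp: c_def intro!: continuous_intros\<close>)
    moreover have "bounded (h z ` {0..T})"
      by (intro compact_imp_bounded compact_continuous_image h_cont that compact_Icc)
    then have "bounded (range (\<lambda>t. h z (c t)))"
      by (rule bounded_subset) (use c in auto)
    ultimately show ?thesis
      by (simp add: bcontfun_def)
  qed
  define P where "P z = Bcontfun (\<lambda>t. h (apply_bcontfun z) (c t))" for z :: "real \<Rightarrow>\<^sub>C real"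
  have P: "apply_bcontfun (P z) t = h z (c t)" for z t
    unfolding P_def using h_bcont[of z] by (simp add: Bcontfun_inverse)
  have "\<exists>!z. P z = z"
  proof (rule banach_fix_type[of "1/2"]; (intro allI)?)
    fix z1 z2 :: "real \<Rightarrow>\<^sub>C real"
    define D where "D = dist z1 z2"
    have "\<bar>h z1 \<tau> - h z2 \<tau>\<bar> \<le> D / 2" if "\<tau> \<in> {0..T}" for \<tau>
    proof -
      let ?F = "\<lambda>z s. f (exp (2 * M * s) * apply_bcontfun z s)"
      \<comment> \<open>Because of the exponent \<open>2 * M\<close> the primitive carries a factor
        1/2, which becomes the contraction constant.\<close>
      have bound: "((\<lambda>s. M * exp (2 * M * s) * D) has_integral
          D / 2 * exp (2 * M * \<tau>) - D / 2 * exp (2 * M * 0)) {0..\<tau>}"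
        using that \<open>0 < M\<close>
        by (intro fundamental_theorem_of_calculus)
          (auto intro!: derivative_eq_intros simp flip: has_real_derivative_iff_has_vector_derivative)
      have "norm (integral {0..\<tau>} (\<lambda>s. ?F z1 s - ?F z2 s)) \<le> integral {0..\<tau>} (\<lambda>s. M * exp (2 * M * s) * D)"
      proof (rule integral_norm_bound_integral)
        show "(\<lambda>s. ?F z1 s - ?F z2 s) integrable_on {0..\<tau>}"
          by (intro integrable_diff integrable) auto
        show "(\<lambda>s. M * exp (2 * M * s) * D) integrable_on {0..\<tau>}"
          using bound by blast
        fix s assume "s \<in> {0..\<tau>}"
        have "\<bar>?F z1 s - ?F z2 s\<bar> \<le> M * \<bar>exp (2 * M * s) * z1 s - exp (2 * M * s) * z2 s\<bar>"
          by (rule f_lip)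
        also have "\<dots> = M * exp (2 * M * s) * \<bar>z1 s - z2 s\<bar>"
          by (simp add: abs_mult flip: right_diff_distrib)
        also have "\<dots> \<le> M * exp (2 * M * s) * D"
          using dist_bounded[of z1 s z2] \<open>0 < M\<close> by (simp add: D_def dist_real_def)
        finally show "norm (?F z1 s - ?F z2 s) \<le> M * exp (2 * M * s) * D"
          by simp
      qed
      also have "\<dots> = D / 2 * (exp (2 * M * \<tau>) - 1)"
        using integral_unique[OF bound] by (simp add: algebra_simps)
      also have "\<dots> \<le> D / 2 * exp (2 * M * \<tau>)"
        by (simp add: D_def mult_left_mono)
      finally have "\<bar>integral {0..\<tau>} (?F z1) - integral {0..\<tau>} (?F z2)\<bar> \<le> D / 2 * exp (2 * M * \<tau>)"
        using integral_diff[OF integrable[of z1 \<tau>] integrable[of z2 \<tau>]] by simp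
      then have "exp (- 2 * M * \<tau>) * \<bar>integral {0..\<tau>} (?F z1) - integral {0..\<tau>} (?F z2)\<bar>
          \<le> exp (- 2 * M * \<tau>) * (D / 2 * exp (2 * M * \<tau>))"
        by simp
      also have "\<dots> = D / 2"
        by (simp add: exp_minus)
      finally show ?thesis
        by (simp add: h_def abs_mult flip: right_diff_distrib)
    qed
    then show "dist (P z1) (P z2) \<le> 1 / 2 * dist z1 z2"
      using c by (intro dist_bound) (auto simp: P D_def dist_real_def)
  qed auto
  then obtain z where z: "P z = z"
    by auto
  define y where "y t = exp (2 * M * t) * z t" for t
  have y: "y t = y0 + integral {0..t} (\<lambda>s. f (y s))" if "t \<in> {0..T}" for t
  proof -
    have "z t = h z t"
      using P[of z t] that z by (simp add: c_def)
    then show ?thesis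
      by (simp add: y_def h_def exp_minus)
  qed
  have "(y has_real_derivative f (y t)) (at t within {0..T})" if "t \<in> {0..T}" for t
  proof -
    have "continuous_on {0..T} (\<lambda>s. f (y s))"
      unfolding y_def by (rule f_int) simp
    then have "((\<lambda>t. integral {0..t} (\<lambda>s. f (y s))) has_real_derivative f (y t)) (at t within {0..T})"
      using that by (rule integral_has_real_derivative)
    from DERIV_add[OF DERIV_const[of y0] this]
    have "((\<lambda>t. y0 + integral {0..t} (\<lambda>s. f (y s))) has_real_derivative f (y t)) (at t within {0..T})"
      by simp
    then show ?thesis
      by (rule has_field_derivative_transform_within[OF _ zero_less_one that]) (simp add: y)
  qed
  moreover have "y 0 = y0"
    using y[of 0] \<open>0 \<le> T\<close> by simp
  ultimately show ?thesis
    unfolding solves_def by blast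
qed

text \<open>This is the mean value theorem for the square of the weighted distance. In the form of
  an equation, it yields an upper or a lower bound according to the sign of the last factor.\<close>

lemma solves_dist_mono:
  assumes y: "solves f T y" and z: "solves f T z" and t: "t \<in> {0..T}"
  obtains s where "s \<in> {0..t}"
    "(exp (- c * t) * (y t - z t))\<^sup>2 - (y 0 - z 0)\<^sup>2 =
       2 * t * (exp (- c * s))\<^sup>2 * ((y s - z s) * (f (y s) - f (z s)) - c * (y s - z s)\<^sup>2)"
proof -
  let ?p = "\<lambda>s. (exp (- c * s) * (y s - z s))\<^sup>2"
  let ?p' = "\<lambda>s. 2 * (exp (- c * s))\<^sup>2 * ((y s - z s) * (f (y s) - f (z s)) - c * (y s - z s)\<^sup>2)"
  have "(?p has_real_derivative ?p' s) (at s within {0..t})" if "s \<in> {0..t}" for s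
  proof -
    have "(y has_real_derivative f (y s)) (at s within {0..t})"
      "(z has_real_derivative f (z s)) (at s within {0..t})"
      using y z t that unfolding solves_def
      by (auto intro!: DERIV_subset[where s = "{0..T}" and t = "{0..t}"])
    then show ?thesis
      by (auto intro!: derivative_eq_intros simp: power2_eq_square algebra_simps)
  qed
  then have "\<exists>s\<in>{0..t}. ?p t - ?p 0 = ?p' s * (t - 0)"
    using t by (intro mvt_very_simple) (auto simp: has_field_derivative_def)
  then show ?thesis
    using that by (auto simp: mult_ac)
qed

text \<open>The one-sided Lipschitz condition allows a negative \<open>c\<close>, and then the flow
  contracts. For equal initial values the bound gives uniqueness.\<close>

lemma solves_dist_le:
  assumes "solves f T y" "solves f T z" "t \<in> {0..T}"
    and "\<And>x x'. (x - x') * (f x - f x') \<le> c * (x - x')\<^sup>2"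
  shows "\<bar>y t - z t\<bar> \<le> exp (c * t) * \<bar>y 0 - z 0\<bar>"
proof -
  have "(exp (- c * t) * (y t - z t))\<^sup>2 \<le> (y 0 - z 0)\<^sup>2"
    using solves_dist_mono[OF assms(1-3), of c] assms(3,4)
    by (smt (verit) atLeastAtMost_iff mult_nonneg_nonpos zero_le_power2 mult_nonneg_nonneg)
  then have "exp (- c * t) * \<bar>y t - z t\<bar> \<le> \<bar>y 0 - z 0\<bar>"
    by (simp add: abs_le_square_iff[symmetric] abs_mult)
  then show ?thesis
    by (simp add: exp_minus field_simps)
qed

text \<open>The reversed condition prevents distinct solutions from merging.\<close>

lemma solves_dist_ge:
  assumes "solves f T y" "solves f T z" "t \<in> {0..T}"
    and "\<And>x x'. c * (x - x')\<^sup>2 \<le> (x - x') * (f x - f x')"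
  shows "exp (c * t) * \<bar>y 0 - z 0\<bar> \<le> \<bar>y t - z t\<bar>"
proof -
  have "(y 0 - z 0)\<^sup>2 \<le> (exp (- c * t) * (y t - z t))\<^sup>2"
    using solves_dist_mono[OF assms(1-3), of c] assms(3,4)
    by (smt (verit) atLeastAtMost_iff mult_nonneg_nonneg zero_le_power2)
  then have "\<bar>y 0 - z 0\<bar> \<le> exp (- c * t) * \<bar>y t - z t\<bar>"
    by (simp add: abs_le_square_iff[symmetric] abs_mult)
  then show ?thesis
    by (simp add: exp_minus field_simps)
qed

text \<open>Subtracting the line through the values at 0 and 1 leaves a solution \<open>r\<close> of
  Jensen's equation with \<open>r 0 = 0\<close>, which is therefore additive. As
  \<open>r 1 = 0\<close>, it vanishes at the integers and has period 1, so its values on the unit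
  interval bound it everywhere. A bounded additive function is zero.\<close>

lemma lipschitz_second_difference_zero_imp_affine:
  fixes g :: "real \<Rightarrow> real"
  assumes lip: "\<And>x y. \<bar>g x - g y\<bar> \<le> L * \<bar>x - y\<bar>"
    and diff: "\<And>x h. g (x + 2 * h) - 2 * g (x + h) + g x = 0"
  shows "g x = g 0 + x * (g 1 - g 0)"
proof -
  define r where "r x = g x - g 0 - x * (g 1 - g 0)" for x
  have mid: "r x + r y = 2 * r ((x + y) / 2)" for x y
    using diff[of x "(y - x) / 2"] by (simp add: r_def field_simps)
  have add: "r (x + y) = r x + r y" for x y
    using mid[of x y] mid[of "x + y" 0] by (simp add: r_def)
  have nat_mult: "r (real n * x) = real n * r x" for n x
    by (induction n) (auto simp: add algebra_simps, simp add: r_def)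
  have minus: "r (- x) = - r x" for x
    using add[of x "- x"] by (simp add: r_def)
  have int_zero: "r (of_int k) = 0" for k
  proof (cases k)
    case (nonneg n)
    then show ?thesis using nat_mult[of n 1] by (simp add: r_def)
  next
    case (neg n)
    then show ?thesis using nat_mult[of "Suc n" 1] minus[of "real (Suc n)"] by (simp add: r_def)
  qed
  define C where "C = \<bar>L\<bar> + \<bar>g 1 - g 0\<bar>"
  have "\<bar>r x\<bar> \<le> C" for x
  proof -
    have "r x = r (frac x)"
      using add[of "frac x" "of_int \<lfloor>x\<rfloor>"] int_zero[of "\<lfloor>x\<rfloor>"] by (simp add: frac_def)
    also have "\<bar>\<dots>\<bar> \<le> \<bar>g (frac x) - g 0\<bar> + \<bar>frac x * (g 1 - g 0)\<bar>"
      unfolding r_def by linarith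
    also have "\<dots> \<le> \<bar>L\<bar> * 1 + 1 * \<bar>g 1 - g 0\<bar>"
    proof (rule add_mono)
      have "\<bar>g (frac x) - g 0\<bar> \<le> L * \<bar>frac x\<bar>"
        using lip[of "frac x" 0] by simp
      also have "\<dots> \<le> \<bar>L\<bar> * 1"
        using frac_lt_1[of x] frac_ge_0[of x] by (intro mult_mono) auto
      finally show "\<bar>g (frac x) - g 0\<bar> \<le> \<bar>L\<bar> * 1" .
      show "\<bar>frac x * (g 1 - g 0)\<bar> \<le> 1 * \<bar>g 1 - g 0\<bar>"
        using frac_lt_1[of x] frac_ge_0[of x] unfolding abs_mult by (intro mult_right_mono) auto
    qed
    finally show ?thesis
      by (simp add: C_def)
  qed
  then have bound: "real n * \<bar>r x\<bar> \<le> C" for n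
    using nat_mult[of n x] by (metis abs_mult abs_of_nat)
  have "r x = 0"
  proof (rule ccontr)
    assume "r x \<noteq> 0"
    then obtain n where "C < real n * \<bar>r x\<bar>"
      using reals_Archimedean3[of "\<bar>r x\<bar>"] by auto
    with bound[of n] show False by simp
  qed
  then show ?thesis
    by (simp add: r_def)
qed

text \<open>The parameter \<open>\<mu>0\<close> lets the contraction be as strong as desired.
  Nonaffinity of \<open>g\<close> is recorded as a nonzero second difference, the starting point for
  differences of higher order.\<close>

lemma nonaffine_time_one_map_exists:
  fixes \<sigma> :: "real \<Rightarrow> real"
  assumes lip: "L-lipschitz_on UNIV \<sigma>"
    and mono: "\<And>x y. \<alpha> * (x - y)\<^sup>2 \<le> (x - y) * (\<sigma> x - \<sigma> y)"
    and nonaffine: "\<not> (\<exists>a c. \<forall>s. \<sigma> s = a * s + c)"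
    and "0 < \<mu>0"
  obtains \<mu> g s h where "\<mu>0 \<le> \<mu>"
    and "\<And>x. \<exists>u. u 0 = x \<and> solves (\<lambda>x. \<sigma> (- \<mu> * x)) 1 u"
    and "\<And>u. solves (\<lambda>x. \<sigma> (- \<mu> * x)) 1 u \<Longrightarrow> u 1 = g (u 0)"
    and "\<And>x y. \<bar>g x - g y\<bar> \<le> exp (- \<alpha> * \<mu>) * \<bar>x - y\<bar>"
    and "g (s + 2 * h) - 2 * g (s + h) + g s \<noteq> 0"
proof -
  have \<sigma>_lip: "\<bar>\<sigma> x - \<sigma> y\<bar> \<le> L * \<bar>x - y\<bar>" for x y
    using lipschitz_onD[OF lip, of x y] by (simp add: dist_real_def)
  define F where "F \<mu> = (\<lambda>x. \<sigma> (- \<mu> * x))" for \<mu>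
  have F_lip: "(L * \<bar>\<mu>\<bar>)-lipschitz_on UNIV (F \<mu>)" for \<mu>
  proof (rule lipschitz_onI)
    fix x y
    have "\<bar>\<mu> * x - \<mu> * y\<bar> = \<bar>\<mu>\<bar> * \<bar>x - y\<bar>"
      by (metis abs_mult right_diff_distrib)
    then show "dist (F \<mu> x) (F \<mu> y) \<le> L * \<bar>\<mu>\<bar> * dist x y"
      using \<sigma>_lip[of "- \<mu> * x" "- \<mu> * y"]
      by (simp add: F_def dist_real_def abs_minus_commute mult.assoc)
  qed (use lipschitz_on_nonneg[OF lip] in simp)
  have F_mono: "(x - y) * (F \<mu> x - F \<mu> y) \<le> (- \<alpha> * \<mu>) * (x - y)\<^sup>2" if "0 < \<mu>" for x y \<mu>
  proof -
    have "\<mu> * ((x - y) * (F \<mu> x - F \<mu> y)) \<le> \<mu> * ((- \<alpha> * \<mu>) * (x - y)\<^sup>2)"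
      using mono[of "- \<mu> * x" "- \<mu> * y"] by (simp add: F_def power2_eq_square algebra_simps)
    then show ?thesis
      by (simp only: mult_le_cancel_left_pos[OF that])
  qed
  have "\<forall>\<mu> s. \<exists>u. u 0 = s \<and> solves (F \<mu>) 1 u"
    using solves_exists[OF F_lip, of 1] by simp
  then obtain U where U: "\<And>\<mu> s. U \<mu> s 0 = s" "\<And>\<mu> s. solves (F \<mu>) 1 (U \<mu> s)"
    by metis
  define G where "G \<mu> s = U \<mu> s 1" for \<mu> s
  have G_eq: "u 1 = G \<mu> (u 0)" if "solves (F \<mu>) 1 u" "0 < \<mu>" for u \<mu>
    using solves_dist_le[OF that(1) U(2)[of \<mu> "u 0"] _ F_mono[OF that(2)], of 1]
    by (simp add: U G_def)
  have G_lip: "\<bar>G \<mu> x - G \<mu> y\<bar> \<le> exp (- \<alpha> * \<mu>) * \<bar>x - y\<bar>" if "0 < \<mu>" for \<mu> x y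
    using solves_dist_le[OF U(2)[of \<mu> x] U(2)[of \<mu> y] _ F_mono[OF that], of 1]
    by (simp add: U G_def)
  have "\<exists>\<mu>\<ge>\<mu>0. \<exists>s h. G \<mu> (s + 2 * h) - 2 * G \<mu> (s + h) + G \<mu> s \<noteq> 0"
  proof (rule ccontr)
    assume *: "\<not> ?thesis"
    have G_affine: "G \<mu> x = G \<mu> 0 + x * (G \<mu> 1 - G \<mu> 0)" if "\<mu>0 \<le> \<mu>" for \<mu> x
    proof (rule lipschitz_second_difference_zero_imp_affine[of "G \<mu>", OF G_lip])
      show "0 < \<mu>"
        using that \<open>0 < \<mu>0\<close> by simp
      show "G \<mu> (s + 2 * h) - 2 * G \<mu> (s + h) + G \<mu> s = 0" for s h
        using * that by blast
    qed
    define T where "T = \<mu>0 + 1"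
    have "\<forall>s. \<exists>w. w 0 = s \<and> solves (\<lambda>x. - \<sigma> x) T w"
      using solves_exists[of L "\<lambda>x. - \<sigma> x" T] lip \<open>0 < \<mu>0\<close> by (simp add: T_def)
    then obtain W where W: "\<And>s. W s 0 = s" "\<And>s. solves (\<lambda>x. - \<sigma> x) T (W s)"
      by metis
    \<comment> \<open>The rescaling turns the parameter \<open>\<mu>\<close> into elapsed time for
      the single equation \<open>w' = - \<sigma> w\<close>, so that differentiating in
      \<open>\<mu>\<close> means using this equation.\<close>
    have W_G: "W s \<mu> = - \<mu> * G \<mu> (- s / \<mu>)" if \<mu>: "\<mu> \<in> {\<mu>0..T}" for s \<mu>
    proof -
      have "0 < \<mu>"
        using \<mu> \<open>0 < \<mu>0\<close> by simp
      define u where "u = (\<lambda>t. - W s (\<mu> * t) / \<mu>)"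
      have "(u has_real_derivative F \<mu> (u t)) (at t within {0..1})" if "t \<in> {0..1}" for t
      proof -
        have "\<mu> * t' \<in> {0..T}" if "t' \<in> {0..1}" for t'
        proof -
          have "\<mu> * t' \<le> \<mu>"
            using that \<open>0 < \<mu>\<close> by (intro mult_left_le) auto
          moreover have "0 \<le> \<mu> * t'"
            using that \<open>0 < \<mu>\<close> by simp
          ultimately show ?thesis
            using \<mu> unfolding atLeastAtMost_iff by linarith
        qed
        then have sub: "(\<lambda>t. \<mu> * t) ` {0..1} \<subseteq> {0..T}" and "\<mu> * t \<in> {0..T}"
          using that by auto
        then have "(W s has_real_derivative - \<sigma> (W s (\<mu> * t))) (at (\<mu> * t) within (\<lambda>t. \<mu> * t) ` {0..1})"
          using W(2)[of s] DERIV_subset[OF _ sub] unfolding solves_def by blast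
        moreover have "((\<lambda>t. \<mu> * t) has_real_derivative \<mu>) (at t within {0..1})"
          by (auto intro!: derivative_eq_intros)
        ultimately have "(W s \<circ> (\<lambda>t. \<mu> * t) has_real_derivative - \<sigma> (W s (\<mu> * t)) * \<mu>) (at t within {0..1})"
          by (rule DERIV_image_chain)
        from DERIV_cmult[OF this, of "- 1 / \<mu>"] show ?thesis
          using \<open>0 < \<mu>\<close> by (simp add: u_def F_def o_def)
      qed
      then have "solves (F \<mu>) 1 u"
        by (simp add: solves_def)
      from G_eq[OF this \<open>0 < \<mu>\<close>] show ?thesis
        using \<open>0 < \<mu>\<close> by (simp add: u_def W field_simps)
    qed
    have W_affine: "W s \<mu> = W 0 \<mu> + s * (W 1 \<mu> - W 0 \<mu>)" if \<mu>: "\<mu> \<in> {\<mu>0..T}" for s \<mu>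
    proof -
      have "W s \<mu> = - \<mu> * G \<mu> 0 + s * (G \<mu> 1 - G \<mu> 0)" for s
        using \<mu> \<open>0 < \<mu>0\<close> by (subst W_G[OF \<mu>], subst G_affine) (auto simp: field_simps)
      then show ?thesis
        by simp
    qed
    \<comment> \<open>This is an interior point of the parameter interval, where the derivative of
      \<open>W s\<close> is two-sided.\<close>
    define \<tau> where "\<tau> = \<mu>0 + 1 / 2"
    have \<tau>: "\<tau> \<in> {0..T}" "\<tau> \<in> {\<mu>0<..<T}" "\<tau> \<in> {\<mu>0..T}"
      using \<open>0 < \<mu>0\<close> by (auto simp: \<tau>_def T_def)
    define p where "p = W 0 \<tau>"
    define q where "q = W 1 \<tau> - W 0 \<tau>"
    \<comment> \<open>The solutions starting at 0 and 1 are still apart at time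
      \<open>\<tau>\<close>, so the affine map taking \<open>s\<close> to
      \<open>W s \<tau> = p + s * q\<close> reaches every real number.\<close>
    have "exp (- L * \<tau>) * \<bar>1\<bar> \<le> \<bar>q\<bar>"
    proof -
      have "- L * (x - x')\<^sup>2 \<le> (x - x') * (- \<sigma> x - - \<sigma> x')" for x x'
      proof -
        have "\<bar>(x - x') * (\<sigma> x - \<sigma> x')\<bar> \<le> \<bar>x - x'\<bar> * (L * \<bar>x - x'\<bar>)"
          unfolding abs_mult by (intro mult_left_mono \<sigma>_lip) simp
        also have "\<dots> = L * (x - x')\<^sup>2"
          by (simp add: power2_eq_square flip: abs_mult)
        finally show ?thesis
          by (simp add: algebra_simps)
      qed
      from solves_dist_ge[OF W(2) W(2) \<tau>(1) this, of 1 0] show ?thesis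
        by (simp add: W q_def)
    qed
    then have "q \<noteq> 0"
      by auto
    have \<sigma>_affine: "\<sigma> (p + s * q) = \<sigma> p + s * (\<sigma> (p + q) - \<sigma> p)" for s
    proof -
      \<comment> \<open>\<open>D\<close> measures the failure of \<open>W\<close> to be affine in
        \<open>s\<close>. It vanishes near \<open>\<tau>\<close>, and its derivative there is the
        same expression formed with \<open>- \<sigma>\<close> along the solutions.\<close>
      define D where "D \<mu> = W s \<mu> - W 0 \<mu> - s * (W 1 \<mu> - W 0 \<mu>)" for \<mu>
      have "(W s has_real_derivative - \<sigma> (W s \<tau>)) (at \<tau>)" for s
        using W(2)[of s] \<tau> \<open>0 < \<mu>0\<close> unfolding solves_def
        by (metis at_within_Icc_at greaterThanLessThan_iff less_trans)
      then have "(D has_real_derivative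
          - \<sigma> (W s \<tau>) - - \<sigma> (W 0 \<tau>) - s * (- \<sigma> (W 1 \<tau>) - - \<sigma> (W 0 \<tau>))) (at \<tau>)"
        unfolding D_def by (intro DERIV_diff DERIV_cmult)
      moreover have "((\<lambda>_. 0) has_real_derivative 0) (at \<tau>)"
        by simp
      then have "(D has_real_derivative 0) (at \<tau>)"
        by (rule has_field_derivative_transform_within_open[of _ _ _ "{\<mu>0<..<T}"])
          (use \<tau> W_affine[of _ s] in \<open>auto simp: D_def\<close>)
      ultimately have "- \<sigma> (W s \<tau>) - - \<sigma> (W 0 \<tau>) - s * (- \<sigma> (W 1 \<tau>) - - \<sigma> (W 0 \<tau>)) = 0"
        by (rule DERIV_unique)
      moreover have "W s \<tau> = p + s * q" "W 1 \<tau> = p + q" "W 0 \<tau> = p"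
        using W_affine[OF \<tau>(3), of s] by (auto simp: p_def q_def)
      ultimately show ?thesis
        by (simp add: algebra_simps)
    qed
    have "\<sigma> x = (\<sigma> (p + q) - \<sigma> p) / q * x + (\<sigma> p - p * (\<sigma> (p + q) - \<sigma> p) / q)" for x
      using \<sigma>_affine[of "(x - p) / q"] \<open>q \<noteq> 0\<close> by (simp add: diff_divide_distrib algebra_simps)
    then show False
      using nonaffine by blast
  qed
  then obtain \<mu> s h where \<mu>: "\<mu>0 \<le> \<mu>" "G \<mu> (s + 2 * h) - 2 * G \<mu> (s + h) + G \<mu> s \<noteq> 0"
    by blast
  with \<open>0 < \<mu>0\<close> have "0 < \<mu>"
    by simp
  show thesis
  proof (rule that[OF \<mu>(1) _ _ _ \<mu>(2)])
    show "\<exists>u. u 0 = x \<and> solves (\<lambda>x. \<sigma> (- \<mu> * x)) 1 u" for x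
      using U[of \<mu> x] unfolding F_def by blast
    show "u 1 = G \<mu> (u 0)" if "solves (\<lambda>x. \<sigma> (- \<mu> * x)) 1 u" for u
      using G_eq[OF _ \<open>0 < \<mu>\<close>] that unfolding F_def by blast
    show "\<bar>G \<mu> x - G \<mu> y\<bar> \<le> exp (- \<alpha> * \<mu>) * \<bar>x - y\<bar>" for x y
      by (rule G_lip[OF \<open>0 < \<mu>\<close>])
  qed
qed

section \<open>One-hidden-layer networks\<close>

definition dot :: "nat \<Rightarrow> (nat \<Rightarrow> real) \<Rightarrow> (nat \<Rightarrow> real) \<Rightarrow> real" where
  "dot m w x = (\<Sum>j<m. w j * x j)"

text \<open>A list entry is a hidden neuron, given by its output coefficient, input weights and
  bias. Concatenating lists adds networks.\<close>

definition net :: "nat \<Rightarrow> (real \<Rightarrow> real) \<Rightarrow> (real \<times> (nat \<Rightarrow> real) \<times> real) list \<Rightarrow> (nat \<Rightarrow> real) \<Rightarrow> real" where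
  "net m g xs x = (\<Sum>(c, w, b)\<leftarrow>xs. c * g (dot m w x + b))"

definition net_closure :: "nat \<Rightarrow> (real \<Rightarrow> real) \<Rightarrow> (nat \<Rightarrow> real) set \<Rightarrow> ((nat \<Rightarrow> real) \<Rightarrow> real) set" where
  "net_closure m g K = {f. \<forall>\<epsilon>>0. \<exists>xs. \<forall>x\<in>K. \<bar>f x - net m g xs x\<bar> \<le> \<epsilon>}"

lemma net_closureD:
  assumes "f \<in> net_closure m g K" "0 < \<epsilon>"
  obtains xs where "\<And>x. x \<in> K \<Longrightarrow> \<bar>f x - net m g xs x\<bar> \<le> \<epsilon>"
  using assms unfolding net_closure_def by blast

lemma net_append: "net m g (xs @ ys) x = net m g xs x + net m g ys x"
  by (simp add: net_def)

text \<open>Halving the tolerance shows that the closure is closed, so later limits may run over its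
  members instead of explicit networks.\<close>

lemma net_closure_limit:
  assumes "\<And>\<epsilon>. 0 < \<epsilon> \<Longrightarrow> \<exists>f'\<in>net_closure m g K. \<forall>x\<in>K. \<bar>f x - f' x\<bar> \<le> \<epsilon>"
  shows "f \<in> net_closure m g K"
  unfolding net_closure_def
proof (intro CollectI allI impI)
  fix \<epsilon> :: real assume "0 < \<epsilon>"
  then obtain f' where f': "f' \<in> net_closure m g K" "\<forall>x\<in>K. \<bar>f x - f' x\<bar> \<le> \<epsilon> / 2"
    using assms[of "\<epsilon> / 2"] by auto
  obtain xs where xs: "\<And>x. x \<in> K \<Longrightarrow> \<bar>f' x - net m g xs x\<bar> \<le> \<epsilon> / 2"
    using net_closureD[OF f'(1)] \<open>0 < \<epsilon>\<close> half_gt_zero by blast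
  have "\<bar>f x - net m g xs x\<bar> \<le> \<epsilon>" if "x \<in> K" for x
    using f'(2)[rule_format, OF that] xs[OF that] by linarith
  then show "\<exists>xs. \<forall>x\<in>K. \<bar>f x - net m g xs x\<bar> \<le> \<epsilon>"
    by blast
qed

lemma net_closure_cong:
  assumes "f \<in> net_closure m g K" "\<And>x. x \<in> K \<Longrightarrow> f x = f' x"
  shows "f' \<in> net_closure m g K"
proof (rule net_closure_limit)
  fix \<epsilon> :: real assume "0 < \<epsilon>"
  with assms show "\<exists>f\<in>net_closure m g K. \<forall>x\<in>K. \<bar>f' x - f x\<bar> \<le> \<epsilon>"
    by (intro bexI[of _ f]) auto
qed

lemma net_closure_ridge: "(\<lambda>x. g (dot m w x + b)) \<in> net_closure m g K"
  unfolding net_closure_def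
proof (intro CollectI allI impI)
  fix \<epsilon> :: real assume "0 < \<epsilon>"
  then show "\<exists>xs. \<forall>x\<in>K. \<bar>g (dot m w x + b) - net m g xs x\<bar> \<le> \<epsilon>"
    by (intro exI[of _ "[(1, w, b)]"]) (simp add: net_def)
qed

lemma net_closure_add:
  assumes f: "f \<in> net_closure m g K" and f': "f' \<in> net_closure m g K"
  shows "(\<lambda>x. f x + f' x) \<in> net_closure m g K"
  unfolding net_closure_def
proof (intro CollectI allI impI)
  fix \<epsilon> :: real assume "0 < \<epsilon>"
  then have "0 < \<epsilon> / 2"
    by simp
  obtain xs where xs: "\<And>x. x \<in> K \<Longrightarrow> \<bar>f x - net m g xs x\<bar> \<le> \<epsilon> / 2"
    using net_closureD[OF f \<open>0 < \<epsilon> / 2\<close>] by blast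
  obtain ys where ys: "\<And>x. x \<in> K \<Longrightarrow> \<bar>f' x - net m g ys x\<bar> \<le> \<epsilon> / 2"
    using net_closureD[OF f' \<open>0 < \<epsilon> / 2\<close>] by blast
  have "\<bar>f x + f' x - net m g (xs @ ys) x\<bar> \<le> \<epsilon>" if "x \<in> K" for x
    using xs[OF that] ys[OF that] unfolding net_append by linarith
  then show "\<exists>xs. \<forall>x\<in>K. \<bar>f x + f' x - net m g xs x\<bar> \<le> \<epsilon>"
    by blast
qed

lemma net_scale: "net m g (map (\<lambda>(c, w, b). (a * c, w, b)) xs) x = a * net m g xs x"
  unfolding net_def by (induction xs) (auto simp: algebra_simps)

lemma net_closure_cmult:
  assumes f: "f \<in> net_closure m g K"
  shows "(\<lambda>x. a * f x) \<in> net_closure m g K"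
  unfolding net_closure_def
proof (intro CollectI allI impI)
  fix \<epsilon> :: real assume "0 < \<epsilon>"
  \<comment> \<open>The added 1 keeps the tolerance positive when \<open>a\<close> is zero.\<close>
  then have "0 < \<epsilon> / (\<bar>a\<bar> + 1)"
    by (simp add: pos_add_strict divide_pos_pos)
  then obtain xs where xs: "\<And>x. x \<in> K \<Longrightarrow> \<bar>f x - net m g xs x\<bar> \<le> \<epsilon> / (\<bar>a\<bar> + 1)"
    using net_closureD[OF f] by blast
  have "\<bar>a * f x - net m g (map (\<lambda>(c, w, b). (a * c, w, b)) xs) x\<bar> \<le> \<epsilon>" if "x \<in> K" for x
  proof -
    have "\<bar>a * f x - a * net m g xs x\<bar> = \<bar>a\<bar> * \<bar>f x - net m g xs x\<bar>"
      by (metis abs_mult right_diff_distrib)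
    also have "\<dots> \<le> (\<bar>a\<bar> + 1) * (\<epsilon> / (\<bar>a\<bar> + 1))"
      using xs[OF that] by (intro mult_mono) auto
    also have "\<dots> = \<epsilon>"
      by (simp add: add_nonneg_eq_0_iff)
    finally show ?thesis
      by (simp only: net_scale)
  qed
  then show "\<exists>xs. \<forall>x\<in>K. \<bar>a * f x - net m g xs x\<bar> \<le> \<epsilon>"
    by blast
qed

lemma net_closure_sum:
  assumes "finite I" "\<And>i. i \<in> I \<Longrightarrow> f i \<in> net_closure m g K"
  shows "(\<lambda>x. \<Sum>i\<in>I. f i x) \<in> net_closure m g K"
  using assms
proof (induction I rule: finite_induct)
  case empty
  show ?case
    using net_closure_cmult[OF net_closure_ridge, of 0] by simp
next
  case (insert i I)
  then show ?case
    by (simp add: net_closure_add)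
qed

lemma dot_fun_upd:
  assumes "i < m"
  shows "dot m (w(i := w i + \<eta>)) x = dot m w x + \<eta> * x i"
proof -
  have "dot m (w(i := w i + \<eta>)) x = (\<Sum>j<m. w j * x j + (if j = i then \<eta> * x j else 0))"
    unfolding dot_def by (intro sum.cong) (auto simp: algebra_simps)
  then show ?thesis
    using assms by (simp add: sum.distrib dot_def)
qed

section \<open>Finite differences of the activation and monomials\<close>

definition fwd_diff :: "real \<Rightarrow> (real \<Rightarrow> real) \<Rightarrow> real \<Rightarrow> real" where
  "fwd_diff h f = (\<lambda>x. f (x + h) - f x)"

text \<open>For an antiderivative \<open>F\<close> the function \<open>F s - s * f x\<close> has
  derivative \<open>f s - f x\<close>, which is at most \<open>L * \<bar>t\<bar>\<close> in absolute
  value on the segment from \<open>x\<close> to \<open>x + t\<close>.\<close>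

lemma lipschitz_primitive:
  fixes f :: "real \<Rightarrow> real"
  assumes lip: "\<And>x y. \<bar>f x - f y\<bar> \<le> L * \<bar>x - y\<bar>"
  obtains F where "\<And>x t. \<bar>F (x + t) - F x - t * f x\<bar> \<le> L * t\<^sup>2"
proof -
  have "0 \<le> L"
    using order_trans[OF abs_ge_zero lip[of 1 0]] by simp
  then have "L-lipschitz_on UNIV f"
    using lip by (auto intro!: lipschitz_onI simp: dist_real_def)
  then have "continuous_on UNIV f"
    by (rule lipschitz_on_continuous_on)
  then have "\<exists>F. \<forall>x. - \<infinity> < ereal x \<longrightarrow> ereal x < \<infinity> \<longrightarrow> (F has_vector_derivative f x) (at x)"
    by (intro einterval_antiderivative) (auto simp: continuous_on_eq_continuous_at)
  then obtain F where F: "\<And>x. (F has_real_derivative f x) (at x)"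
    by (auto simp: has_real_derivative_iff_has_vector_derivative)
  have "\<bar>F (x + t) - F x - t * f x\<bar> \<le> L * t\<^sup>2" for x t
  proof -
    have "norm ((F (x + t) - (x + t) * f x) - (F x - x * f x)) \<le> (L * \<bar>t\<bar>) * norm ((x + t) - x)"
    proof (rule field_differentiable_bound[where S = "closed_segment x (x + t)"])
      fix s assume s: "s \<in> closed_segment x (x + t)"
      show "((\<lambda>s. F s - s * f x) has_real_derivative f s - f x) (at s within closed_segment x (x + t))"
        using F[of s, THEN has_field_derivative_at_within]
        by (auto intro!: derivative_eq_intros)
      have "\<bar>s - x\<bar> \<le> \<bar>t\<bar>"
        using segment_bound1[OF s] by (simp add: abs_minus_commute)
      then show "norm (f s - f x) \<le> L * \<bar>t\<bar>"
        using order_trans[OF lip mult_left_mono[OF _ \<open>0 \<le> L\<close>]] by simp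
    qed auto
    then show ?thesis
      by (simp add: algebra_simps power2_eq_square)
  qed
  with that show thesis .
qed

text \<open>The derivative of \<open>p x * (\<integral>t\<in>{0..h}. f (dot m w x + b + t))\<close> with respect to the weight
  \<open>w i\<close> is in the closure. The integral is a difference of values of a primitive of \<open>f\<close>, so
  \<open>f\<close> itself need not be differentiable.\<close>

lemma net_closure_fwd_diff:
  assumes f_lip: "\<And>x y. \<bar>f x - f y\<bar> \<le> L * \<bar>x - y\<bar>"
    and p: "\<And>x. x \<in> K \<Longrightarrow> \<bar>p x\<bar> \<le> P"
    and B: "\<And>x. x \<in> K \<Longrightarrow> \<bar>x i\<bar> \<le> B"
    and "i < m"
    and f: "\<And>w b. (\<lambda>x. p x * f (dot m w x + b)) \<in> net_closure m g K"
  shows "(\<lambda>x. x i * p x * fwd_diff h f (dot m w x + b)) \<in> net_closure m g K"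
proof (rule net_closure_limit)
  fix \<epsilon> :: real assume "0 < \<epsilon>"
  obtain F where F: "\<And>x t. \<bar>F (x + t) - F x - t * f x\<bar> \<le> L * t\<^sup>2"
    using lipschitz_primitive[OF f_lip] by blast
  have "0 \<le> L"
    using order_trans[OF abs_ge_zero f_lip[of 1 0]] by simp
  define Q where "Q = (\<bar>P\<bar> + 1) * (L + 1) * (B\<^sup>2 + 1)"
  have "0 < Q"
    using \<open>0 \<le> L\<close> unfolding Q_def by (intro mult_pos_pos) (auto intro: add_nonneg_pos)
  \<comment> \<open>The weight increment \<open>\<eta>\<close> makes the error of the difference
    quotient at most \<open>\<epsilon> / 2\<close>. The number \<open>n\<close> of nodes is chosen
    afterwards, since the error of the Riemann sums gets divided by \<open>\<eta>\<close>.\<close>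
  define \<eta> where "\<eta> = \<epsilon> / (4 * Q)"
  have "0 < \<eta>"
    using \<open>0 < \<epsilon>\<close> \<open>0 < Q\<close> by (simp add: \<eta>_def)
  obtain n where n: "4 * \<bar>P\<bar> * L * h\<^sup>2 / (\<epsilon> * \<eta>) < real n"
    using reals_Archimedean2 by blast
  have "0 < real n"
    using \<open>0 < \<epsilon>\<close> \<open>0 < \<eta>\<close> \<open>0 \<le> L\<close> by (intro le_less_trans[OF _ n]) simp
  \<comment> \<open>\<open>S y\<close> is the Riemann sum with left nodes for the integral of
    \<open>f\<close> from \<open>y\<close> to \<open>y + h\<close>. \<open>A\<close> below is its
    difference quotient in the weight \<open>w i\<close>, multiplied by \<open>p x\<close>; it is a
    finite combination of functions covered by the hypothesis \<open>f\<close>.\<close>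
  define S where "S y = (\<Sum>j<n. h / n * f (y + real j * (h / n)))" for y
  have S: "\<bar>F (y + h) - F y - S y\<bar> \<le> L * h\<^sup>2 / n" for y
  proof -
    let ?y = "\<lambda>j. y + real j * (h / n)"
    have Suc: "?y (Suc j) = ?y j + h / n" for j
      by (simp add: distrib_right add_divide_distrib)
    have "F (y + h) - F y = (\<Sum>j<n. F (?y (Suc j)) - F (?y j))"
      using \<open>0 < real n\<close> by (subst sum_lessThan_telescope) simp
    then have "F (y + h) - F y - S y = (\<Sum>j<n. F (?y j + h / n) - F (?y j) - h / n * f (?y j))"
      by (simp only: S_def Suc sum_subtractf)
    then have "\<bar>F (y + h) - F y - S y\<bar> = \<bar>\<Sum>j<n. F (?y j + h / n) - F (?y j) - h / n * f (?y j)\<bar>"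
      by simp
    also have "\<dots> \<le> (\<Sum>j<n. L * (h / n)\<^sup>2)"
      by (rule order_trans[OF sum_abs sum_mono]) (rule F)
    also have "\<dots> = L * h\<^sup>2 / n"
      using \<open>0 < real n\<close> by (simp add: power2_eq_square)
    finally show ?thesis .
  qed
  define A where "A = (\<lambda>x. \<Sum>j<n. h / n / \<eta> *
    (p x * f (dot m (w(i := w i + \<eta>)) x + (b + real j * (h / n)))
      + - 1 * (p x * f (dot m w x + (b + real j * (h / n))))))"
  have "A \<in> net_closure m g K"
    unfolding A_def by (intro net_closure_sum net_closure_cmult net_closure_add f) auto
  moreover have "\<bar>x i * p x * fwd_diff h f (dot m w x + b) - A x\<bar> \<le> \<epsilon>" if "x \<in> K" for x
  proof -
    define y where "y = dot m w x + b"
    define t where "t = \<eta> * x i"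
    have "A x = (\<Sum>j<n. p x / \<eta> *
        (h / n * f (y + t + real j * (h / n)) - h / n * f (y + real j * (h / n))))"
      unfolding A_def dot_fun_upd[OF \<open>i < m\<close>] y_def t_def
      by (intro sum.cong refl) (simp add: right_diff_distrib add_ac mult_ac)
    also have "\<dots> = p x / \<eta> * (S (y + t) - S y)"
      by (simp only: sum_distrib_left[symmetric] sum_subtractf S_def)
    finally have "x i * p x * fwd_diff h f (dot m w x + b) - A x
        = p x * (t * (f (y + h) - f y) - (S (y + t) - S y)) / \<eta>"
      using \<open>0 < \<eta>\<close> by (simp add: fwd_diff_def y_def t_def field_simps)
    then have "\<bar>x i * p x * fwd_diff h f (dot m w x + b) - A x\<bar>
        = \<bar>p x\<bar> * \<bar>t * (f (y + h) - f y) - (S (y + t) - S y)\<bar> / \<eta>"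
      using \<open>0 < \<eta>\<close> by (simp add: abs_mult)
    also have "\<dots> \<le> \<bar>P\<bar> * (2 * L * (\<eta>\<^sup>2 * B\<^sup>2) + 2 * (L * h\<^sup>2 / n)) / \<eta>"
    proof (intro divide_right_mono mult_mono)
      \<comment> \<open>The mixed second difference of \<open>F\<close> is regrouped into two
        increments of length \<open>t\<close>, based at \<open>y + h\<close> and at
        \<open>y\<close>. Each of them costs \<open>L * t\<^sup>2\<close>, and each of the two
        Riemann sums costs \<open>L * h\<^sup>2 / n\<close>.\<close>
      have swap: "y + t + h = y + h + t"
        by simp
      have "\<bar>t * (f (y + h) - f y) - (S (y + t) - S y)\<bar> \<le> 2 * L * t\<^sup>2 + 2 * (L * h\<^sup>2 / n)"
        using F[of "y + h" t] F[of y t] S[of y] S[of "y + t"]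
        unfolding right_diff_distrib swap mult.assoc by linarith
      also have "t\<^sup>2 \<le> \<eta>\<^sup>2 * B\<^sup>2"
        using B[OF that] by (simp add: t_def power_mult_distrib mult_left_mono abs_le_square_iff[symmetric])
      finally show "\<bar>t * (f (y + h) - f y) - (S (y + t) - S y)\<bar> \<le> 2 * L * (\<eta>\<^sup>2 * B\<^sup>2) + 2 * (L * h\<^sup>2 / n)"
        using \<open>0 \<le> L\<close> by (simp add: mult_left_mono)
    qed (use p[OF that] \<open>0 < \<eta>\<close> in auto)
    also have "\<dots> = 2 * \<bar>P\<bar> * L * B\<^sup>2 * \<eta> + 2 * \<bar>P\<bar> * L * h\<^sup>2 / (n * \<eta>)"
      using \<open>0 < \<eta>\<close> \<open>0 < real n\<close> by (simp add: field_simps power2_eq_square)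
    also have "\<dots> \<le> \<epsilon> / 2 + \<epsilon> / 2"
    proof (rule add_mono)
      have "\<bar>P\<bar> * L * B\<^sup>2 \<le> Q"
        unfolding Q_def using \<open>0 \<le> L\<close> by (intro mult_mono) auto
      then have "2 * (\<bar>P\<bar> * L * B\<^sup>2) * \<eta> \<le> 2 * Q * \<eta>"
        using \<open>0 < \<eta>\<close> by simp
      also have "\<dots> = \<epsilon> / 2"
        using \<open>0 < Q\<close> by (simp add: \<eta>_def)
      finally show "2 * \<bar>P\<bar> * L * B\<^sup>2 * \<eta> \<le> \<epsilon> / 2"
        by (simp add: mult.assoc)
      have "4 * \<bar>P\<bar> * L * h\<^sup>2 < real n * (\<epsilon> * \<eta>)"
        using n \<open>0 < \<epsilon>\<close> \<open>0 < \<eta>\<close> by (simp add: pos_divide_less_eq)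
      then show "2 * \<bar>P\<bar> * L * h\<^sup>2 / (n * \<eta>) \<le> \<epsilon> / 2"
        using \<open>0 < real n\<close> \<open>0 < \<eta>\<close> by (simp add: field_simps)
    qed
    finally show ?thesis
      by simp
  qed
  ultimately show "\<exists>f'\<in>net_closure m g K. \<forall>x\<in>K. \<bar>x i * p x * fwd_diff h f (dot m w x + b) - f' x\<bar> \<le> \<epsilon>"
    by blast
qed

lemma fwd_diff_funpow_lipschitz:
  assumes lip: "\<And>x y. \<bar>g x - g y\<bar> \<le> L * \<bar>x - y\<bar>"
  shows "\<bar>(fwd_diff h ^^ k) g x - (fwd_diff h ^^ k) g y\<bar> \<le> 2 ^ k * L * \<bar>x - y\<bar>"
proof (induction k arbitrary: x y)
  case 0
  then show ?case
    using lip by simp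
next
  case (Suc k)
  from Suc.IH[of "x + h" "y + h"] Suc.IH[of x y] show ?case
    by (simp add: fwd_diff_def)
qed

text \<open>One more difference turns the Lipschitz bound of order \<open>k\<close> into a bound
  uniform in \<open>x\<close>, which rules out linear growth.\<close>

lemma fwd_diff_funpow_bounded:
  assumes lip: "\<And>x y. \<bar>g x - g y\<bar> \<le> L * \<bar>x - y\<bar>"
  shows "\<bar>(fwd_diff h ^^ Suc k) g x\<bar> \<le> 2 ^ k * L * \<bar>h\<bar>"
  using fwd_diff_funpow_lipschitz[OF lip, where k = k and x = "x + h" and y = x]
  by (simp add: fwd_diff_def)

text \<open>A bounded sequence whose second difference vanishes is constant, so if the difference of
  some order \<open>k \<ge> 3\<close> vanishes, then so does the one of order \<open>k - 1\<close>.\<close>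

lemma fwd_diff_funpow_nonzero:
  assumes lip: "\<And>x y. \<bar>g x - g y\<bar> \<le> L * \<bar>x - y\<bar>"
    and nonzero: "(fwd_diff h ^^ 2) g s \<noteq> 0"
  shows "\<exists>x. (fwd_diff h ^^ k) g x \<noteq> 0"
proof -
  have large: "\<exists>x. (fwd_diff h ^^ (k + 2)) g x \<noteq> 0" for k
  proof (induction k)
    case 0
    show ?case
      using nonzero by (auto simp: numeral_2_eq_2)
  next
    case (Suc k)
    show ?case
    proof (rule ccontr)
      \<comment> \<open>The order is at least one, so \<open>a\<close> is bounded, although
        \<open>g\<close> itself may not be.\<close>
      define a where "a = (fwd_diff h ^^ Suc k) g"
      assume "\<not> ?thesis"
      then have zero: "fwd_diff h (fwd_diff h a) x = 0" for x
        by (simp add: a_def)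
      have const: "fwd_diff h a (x + real j * h) = fwd_diff h a x" for x j
      proof (induction j)
        case (Suc j)
        then show ?case
          using zero[of "x + real j * h"] by (simp add: fwd_diff_def algebra_simps)
      qed simp
      have linear: "a (x + real j * h) = a x + real j * fwd_diff h a x" for x j
      proof (induction j)
        case (Suc j)
        then show ?case
          using const[of x j] by (simp add: fwd_diff_def algebra_simps)
      qed simp
      define C where "C = 2 ^ k * L * \<bar>h\<bar>"
      have bound: "\<bar>a x\<bar> \<le> C" for x
        unfolding a_def C_def by (rule fwd_diff_funpow_bounded[OF lip])
      have "fwd_diff h a x = 0" for x
      proof (rule ccontr)
        assume "fwd_diff h a x \<noteq> 0"
        then obtain j where "2 * C < real j * \<bar>fwd_diff h a x\<bar>"
          using reals_Archimedean3[of "\<bar>fwd_diff h a x\<bar>"] by auto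
        moreover have "real j * \<bar>fwd_diff h a x\<bar> = \<bar>a (x + real j * h) - a x\<bar>"
          using linear[of x j] by (simp add: abs_mult)
        ultimately show False
          using bound[of x] bound[of "x + real j * h"] by linarith
      qed
      with Suc show False
        by (simp add: a_def)
    qed
  qed
  show ?thesis
  proof (cases "2 \<le> k")
    case True
    then show ?thesis
      using large[of "k - 2"] by (simp only: le_add_diff_inverse2)
  next
    case False
    \<comment> \<open>For orders below two, a vanishing difference would force the second one to
      vanish.\<close>
    have zero_diff: "(fwd_diff h ^^ (k + j)) g x = 0" if "\<And>x. (fwd_diff h ^^ k) g x = 0" for j x
      using that by (induction j arbitrary: x) (auto simp: fwd_diff_def)
    from False have "k + (2 - k) = 2"
      by simp
    with zero_diff[of "2 - k" s] nonzero show ?thesis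
      by metis
  qed
qed

text \<open>Each use of \<open>net_closure_fwd_diff\<close> contributes one coordinate and one order
  of difference. Zero weights then reduce the ridge factor to a constant, which a suitable bias
  makes nonzero. The list may repeat indices, so all powers occur.\<close>

lemma monomial_mem_net_closure:
  assumes lip: "\<And>x y. \<bar>g x - g y\<bar> \<le> L * \<bar>x - y\<bar>"
    and nonzero: "(fwd_diff h ^^ 2) g s \<noteq> 0"
    and B: "\<And>x i. x \<in> K \<Longrightarrow> i < m \<Longrightarrow> \<bar>x i\<bar> \<le> B"
    and "set is \<subseteq> {..<m}"
  shows "(\<lambda>x. \<Prod>i\<leftarrow>is. x i) \<in> net_closure m g K"
proof -
  have "\<forall>w b. (\<lambda>x. (\<Prod>i\<leftarrow>is. x i) * (fwd_diff h ^^ length is) g (dot m w x + b)) \<in> net_closure m g K"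
    using \<open>set is \<subseteq> {..<m}\<close>
  proof (induction "is")
    case Nil
    show ?case
      by (simp add: net_closure_ridge)
  next
    case (Cons i "is")
    have "\<bar>\<Prod>i\<leftarrow>is. x i\<bar> \<le> \<bar>B\<bar> ^ length is" if "x \<in> K" for x
      using \<open>set (i # is) \<subseteq> {..<m}\<close>
    proof (induction "is")
      case (Cons j js)
      have "\<bar>x j\<bar> \<le> \<bar>B\<bar>"
        using B[OF that, of j] Cons.prems by auto
      with Cons show ?case
        by (auto simp: abs_mult intro!: mult_mono)
    qed simp
    then show ?case
      using Cons B
      by (auto intro!: net_closure_fwd_diff[OF fwd_diff_funpow_lipschitz[OF lip]])
  qed
  moreover obtain b where b: "(fwd_diff h ^^ length is) g b \<noteq> 0"
    using fwd_diff_funpow_nonzero[OF lip nonzero] by blast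
  ultimately have "(\<lambda>x. (\<Prod>i\<leftarrow>is. x i) * (fwd_diff h ^^ length is) g (dot m (\<lambda>_. 0) x + b)) \<in> net_closure m g K"
    by blast
  from net_closure_cmult[OF this, of "1 / (fwd_diff h ^^ length is) g b"] b show ?thesis
    by (simp add: dot_def)
qed

section \<open>Polynomials and uniform density\<close>

inductive_set polynomial_functions :: "nat \<Rightarrow> ((nat \<Rightarrow> real) \<Rightarrow> real) set" for m where
  const: "(\<lambda>_. c) \<in> polynomial_functions m"
| add: "p \<in> polynomial_functions m \<Longrightarrow> q \<in> polynomial_functions m \<Longrightarrow>
    (\<lambda>x. p x + q x) \<in> polynomial_functions m"
| coord_mult: "p \<in> polynomial_functions m \<Longrightarrow> i < m \<Longrightarrow> (\<lambda>x. x i * p x) \<in> polynomial_functions m"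

lemma polynomial_functions_cmult:
  assumes "p \<in> polynomial_functions m"
  shows "(\<lambda>x. c * p x) \<in> polynomial_functions m"
  using assms
proof (induction p rule: polynomial_functions.induct)
  case (const a)
  show ?case
    by (rule polynomial_functions.const)
next
  case (add p q)
  then show ?case
    using polynomial_functions.add by (simp add: distrib_left)
next
  case (coord_mult p i)
  then show ?case
    using polynomial_functions.coord_mult[of "\<lambda>x. c * p x" m i] by (simp add: mult.left_commute)
qed

lemma polynomial_functions_mult:
  assumes "p \<in> polynomial_functions m" and q: "q \<in> polynomial_functions m"
  shows "(\<lambda>x. p x * q x) \<in> polynomial_functions m"
  using assms(1)
proof (induction p rule: polynomial_functions.induct)
  case (const c)
  show ?case
    by (rule polynomial_functions_cmult[OF q])
next
  case (add p p')
  then show ?case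
    using polynomial_functions.add by (simp add: distrib_right)
next
  case (coord_mult p i)
  then show ?case
    using polynomial_functions.coord_mult[of "\<lambda>x. p x * q x" m i] by (simp add: mult.assoc)
qed

lemma continuous_on_polynomial_function:
  assumes "p \<in> polynomial_functions m"
  shows "continuous_on S p"
  using assms
proof (induction p rule: polynomial_functions.induct)
  case (coord_mult p i)
  then show ?case
    by (intro continuous_intros continuous_on_subset[OF continuous_on_product_coordinates subset_UNIV])
qed (auto intro!: continuous_intros)

text \<open>The induction carries a monomial factor that absorbs the new coordinate in the case
  \<open>coord_mult\<close>. This is why polynomials are generated by multiplication with
  coordinates and not by general products.\<close>

lemma polynomial_mem_net_closure:
  assumes monomials: "\<And>is. set is \<subseteq> {..<m} \<Longrightarrow> (\<lambda>x. \<Prod>i\<leftarrow>is. x i) \<in> net_closure m g K"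
    and "p \<in> polynomial_functions m"
  shows "p \<in> net_closure m g K"
proof -
  have "(\<lambda>x. (\<Prod>i\<leftarrow>is. x i) * p x) \<in> net_closure m g K" if "set is \<subseteq> {..<m}" for "is"
    using \<open>p \<in> polynomial_functions m\<close> that
  proof (induction p arbitrary: "is" rule: polynomial_functions.induct)
    case (const c)
    from net_closure_cmult[OF monomials[OF const], of c] show ?case
      by (simp add: mult.commute)
  next
    case (add p q)
    from net_closure_add[OF add.IH(1)[OF add.prems] add.IH(2)[OF add.prems]] show ?case
      by (simp add: distrib_left)
  next
    case (coord_mult p i)
    from coord_mult.IH[of "i # is"] coord_mult show ?case
      by (simp add: mult_ac)
  qed
  from this[of "[]"] show ?thesis
    by simp
qed

text \<open>The points of \<open>K\<close> vanish from index \<open>m\<close> on, so the first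
  \<open>m\<close> coordinates separate them and the Stone-Weierstrass theorem applies to
  polynomials in these coordinates.\<close>

lemma continuous_mem_net_closure:
  assumes lip: "\<And>x y. \<bar>g x - g y\<bar> \<le> L * \<bar>x - y\<bar>"
    and nonzero: "(fwd_diff h ^^ 2) g s \<noteq> 0"
    and "compact K" and K: "\<And>x i. x \<in> K \<Longrightarrow> m \<le> i \<Longrightarrow> x i = 0"
    and f: "continuous_on K f"
  shows "f \<in> net_closure m g K"
proof -
  have "\<exists>B. \<forall>x\<in>K. \<bar>x i\<bar> \<le> B" for i
  proof -
    have "bounded ((\<lambda>x. x i) ` K)"
      by (intro compact_imp_bounded compact_continuous_image \<open>compact K\<close>
          continuous_on_subset[OF continuous_on_product_coordinates subset_UNIV])
    then show ?thesis
      by (auto simp: bounded_iff)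
  qed
  then obtain B where B: "\<And>i x. x \<in> K \<Longrightarrow> \<bar>x i\<bar> \<le> B i"
    by metis
  define C where "C = (\<Sum>i<m. \<bar>B i\<bar>)"
  have C: "\<bar>x i\<bar> \<le> C" if "x \<in> K" "i < m" for x i
  proof -
    have "\<bar>x i\<bar> \<le> \<bar>B i\<bar>"
      using B[OF that(1), of i] by simp
    also have "\<dots> \<le> C"
      unfolding C_def using that(2) by (intro member_le_sum) auto
    finally show ?thesis .
  qed
  interpret function_ring_on "polynomial_functions m" K
  proof
    fix x y :: "nat \<Rightarrow> real"
    assume "x \<in> K" "y \<in> K" "x \<noteq> y"
    then obtain i where "x i \<noteq> y i" "i < m"
      using K by (metis ext not_le)
    moreover have "(\<lambda>x. x i * 1) \<in> polynomial_functions m"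
      using \<open>i < m\<close> by (intro polynomial_functions.intros)
    ultimately show "\<exists>p\<in>polynomial_functions m. p x \<noteq> p y"
      by (intro bexI[of _ "\<lambda>x. x i * 1"]) auto
  qed (use \<open>compact K\<close> in \<open>auto intro: continuous_on_polynomial_function polynomial_functions.intros
      polynomial_functions_mult\<close>)
  show ?thesis
  proof (rule net_closure_limit)
    fix \<epsilon> :: real assume "0 < \<epsilon>"
    then obtain p where "p \<in> polynomial_functions m" "\<forall>x\<in>K. \<bar>f x - p x\<bar> < \<epsilon>"
      using Stone_Weierstrass_basic[OF f] by blast
    moreover have "p \<in> net_closure m g K"
      using \<open>p \<in> polynomial_functions m\<close>
      by (rule polynomial_mem_net_closure[rotated])
        (rule monomial_mem_net_closure[OF lip nonzero], use C in auto)
    ultimately show "\<exists>p\<in>net_closure m g K. \<forall>x\<in>K. \<bar>f x - p x\<bar> \<le> \<epsilon>"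
      by (meson less_imp_le)
  qed
qed

text \<open>The scalar networks are placed side by side in one hidden layer. The neurons of a block
  feed only their own output coordinate, so the errors do not accumulate.\<close>

lemma net_closure_vector:
  fixes n :: nat
  assumes "\<And>i. i < n \<Longrightarrow> f i \<in> net_closure m g K" and "0 < \<epsilon>"
  shows "\<exists>ys. ys \<noteq> [] \<and>
    (\<forall>x\<in>K. \<forall>i. \<bar>(if i < n then f i x else 0) - (\<Sum>(c, w, b)\<leftarrow>ys. c i * g (dot m w x + b))\<bar> \<le> \<epsilon>)"
  using assms(1)
proof (induction n)
  case 0
  show ?case
    \<comment> \<open>A neuron with zero output keeps the list nonempty, as the hidden dimension has
      to be positive.\<close>
    using \<open>0 < \<epsilon>\<close> by (intro exI[of _ "[(\<lambda>_. 0, \<lambda>_. 0, 0)]"]) simp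
next
  case (Suc n)
  then obtain ys where "ys \<noteq> []" and ys: "\<And>x i. x \<in> K \<Longrightarrow>
      \<bar>(if i < n then f i x else 0) - (\<Sum>(c, w, b)\<leftarrow>ys. c i * g (dot m w x + b))\<bar> \<le> \<epsilon>"
    by force
  obtain xs where xs: "\<And>x. x \<in> K \<Longrightarrow> \<bar>f n x - net m g xs x\<bar> \<le> \<epsilon>"
    using net_closureD[OF Suc.prems[of n] \<open>0 < \<epsilon>\<close>] by auto
  define zs where "zs = map (\<lambda>(c, w, b). (\<lambda>i. if i = n then c else 0 :: real, w, b)) xs"
  define ys' where "ys' = map (\<lambda>(c, w, b). (c(n := 0), w, b)) ys"
  have zs: "(\<Sum>(c, w, b)\<leftarrow>zs. c i * g (dot m w x + b)) = (if i = n then net m g xs x else 0)" for x i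
    unfolding zs_def net_def by (induction xs) auto
  have ys': "(\<Sum>(c, w, b)\<leftarrow>ys'. c i * g (dot m w x + b))
      = (if i = n then 0 else (\<Sum>(c, w, b)\<leftarrow>ys. c i * g (dot m w x + b)))" for x i
    unfolding ys'_def by (induction ys) auto
  have "\<bar>(if i < Suc n then f i x else 0) - (\<Sum>(c, w, b)\<leftarrow>ys' @ zs. c i * g (dot m w x + b))\<bar> \<le> \<epsilon>"
    if "x \<in> K" for x i
  proof (cases "i = n")
    case True
    then show ?thesis
      using xs[OF that] by (simp only: map_append sum_list_append zs ys') simp
  next
    case False
    then show ?thesis
      using ys[OF that, of i] by (simp only: map_append sum_list_append zs ys' less_Suc_eq) simp
  qed
  moreover have "ys' @ zs \<noteq> []"
    using \<open>ys \<noteq> []\<close> by (simp add: ys'_def)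
  ultimately show ?case
    by blast
qed

section \<open>Flows of scalar matrices\<close>

definition scalar_matrix :: "real \<Rightarrow> nat \<Rightarrow> nat \<Rightarrow> real" where
  "scalar_matrix a = (\<lambda>i j. if i = j then a else 0)"

text \<open>A scalar matrix decouples the system into \<open>d\<close> copies of one scalar
  equation, whose existence and uniqueness properties settle the definite description in
  \<open>flow_map\<close>.\<close>

lemma flow_map_scalar_matrix:
  assumes ex: "\<And>x. \<exists>u. u 0 = x \<and> solves (\<lambda>x. \<sigma> (a * x)) 1 u"
    and unique: "\<And>u. solves (\<lambda>x. \<sigma> (a * x)) 1 u \<Longrightarrow> u 1 = g (u 0)"
    and "u0 \<in> Rn d"
  shows "flow_map \<sigma> d (scalar_matrix a) (\<lambda>_. 0) u0 = (\<lambda>i. if i < d then g (u0 i) else 0)"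
proof -
  have affine: "affine_map d d (scalar_matrix a) (\<lambda>_. 0) x i = a * x i" if "i < d" for x i
  proof -
    have "(\<Sum>j<d. scalar_matrix a i j * x j) = (\<Sum>j<d. if j = i then a * x j else 0)"
      by (intro sum.cong) (auto simp: scalar_matrix_def)
    then show ?thesis
      using that by (simp add: affine_map_def)
  qed
  have ode: "ode_solution \<sigma> d (scalar_matrix a) (\<lambda>_. 0) u0 u \<longleftrightarrow>
      u 0 = u0 \<and> (\<forall>t\<in>{0..1}. u t \<in> Rn d) \<and> (\<forall>i<d. solves (\<lambda>x. \<sigma> (a * x)) 1 (\<lambda>t. u t i))" for u
    unfolding ode_solution_def solves_def by (auto simp: affine)
  obtain y where y: "\<And>x. y x 0 = x" "\<And>x. solves (\<lambda>x. \<sigma> (a * x)) 1 (y x)"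
    using ex by metis
  show ?thesis
    unfolding flow_map_def
  proof (rule the_equality)
    define u where "u t i = (if i < d then y (u0 i) t else 0)" for t i
    have "u 0 = u0"
      using \<open>u0 \<in> Rn d\<close> by (auto simp: u_def y topspace_Euclidean_space)
    moreover have "solves (\<lambda>x. \<sigma> (a * x)) 1 (\<lambda>t. u t i)" if "i < d" for i
      using y(2)[of "u0 i"] that by (simp add: u_def)
    ultimately have "ode_solution \<sigma> d (scalar_matrix a) (\<lambda>_. 0) u0 u"
      unfolding ode by (simp add: u_def topspace_Euclidean_space)
    moreover have "(\<lambda>i. if i < d then g (u0 i) else 0) = u 1"
      using unique[OF y(2)] y(1) by (auto simp: u_def)
    ultimately show "\<exists>u. ode_solution \<sigma> d (scalar_matrix a) (\<lambda>_. 0) u0 u \<and>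
        (\<lambda>i. if i < d then g (u0 i) else 0) = u 1"
      by blast
  next
    fix v assume "\<exists>u. ode_solution \<sigma> d (scalar_matrix a) (\<lambda>_. 0) u0 u \<and> v = u 1"
    then obtain u where u: "ode_solution \<sigma> d (scalar_matrix a) (\<lambda>_. 0) u0 u" "v = u 1"
      by blast
    then have "u 1 \<in> Rn d" "u 0 = u0"
      by (auto simp: ode)
    moreover have "u 1 i = g (u0 i)" if "i < d" for i
      using u that unique[of "\<lambda>t. u t i"] by (auto simp: ode)
    ultimately show "v = (\<lambda>i. if i < d then g (u0 i) else 0)"
      using u(2) by (auto simp: topspace_Euclidean_space)
  qed
qed

text \<open>The bound does not depend on \<open>d\<close>, so the width can grow while the Lipschitz
  constant stays controlled.\<close>

lemma Lip_componentwise_le: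
  assumes \<phi>: "\<And>x i. x \<in> Rn d \<Longrightarrow> i < d \<Longrightarrow> \<phi> x i = g (x i)"
    and g: "\<And>x y. \<bar>g x - g y\<bar> \<le> L * \<bar>x - y\<bar>"
  shows "Lip d \<phi> \<le> ereal L"
proof -
  have "0 \<le> L"
    using order_trans[OF abs_ge_zero g[of 1 0]] by simp
  have "L2_set (\<lambda>i. \<phi> x i - \<phi> y i) {..<d} \<le> L * L2_set (\<lambda>i. x i - y i) {..<d}"
    if "x \<in> Rn d" "y \<in> Rn d" for x y
  proof -
    have "(\<phi> x i - \<phi> y i)\<^sup>2 \<le> (L * (x i - y i))\<^sup>2" if "i < d" for i
      using g[of "x i" "y i"] \<phi> \<open>x \<in> Rn d\<close> \<open>y \<in> Rn d\<close> \<open>0 \<le> L\<close> that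
      by (simp add: abs_le_square_iff[symmetric] abs_mult)
    then have "L2_set (\<lambda>i. \<phi> x i - \<phi> y i) {..<d} \<le> L2_set (\<lambda>i. L * (x i - y i)) {..<d}"
      unfolding L2_set_def by (intro real_sqrt_le_mono sum_mono) auto
    then show ?thesis
      using L2_set_right_distrib[OF \<open>0 \<le> L\<close>, of "\<lambda>i. x i - y i" "{..<d}"] by simp
  qed
  then show ?thesis
    unfolding Lip_def using \<open>0 \<le> L\<close> by (intro INF_lower) simp
qed

text \<open>Expanding in unit vectors, one coordinate at a time, reduces approximation in an
  arbitrary norm to approximation of each coordinate.\<close>

lemma norm_on_Rn_le_sum:
  assumes N: "norm_on_Rn n N" and v: "v \<in> Rn n"
  shows "N v \<le> (\<Sum>i<n. \<bar>v i\<bar> * N (\<lambda>j. if j = i then 1 else 0))"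
proof -
  let ?e = "\<lambda>i j :: nat. if j = i then 1 else 0 :: real"
  have zero: "N (\<lambda>i. 0) = 0" if "(\<lambda>i. 0) \<in> Rn n"
    using N that unfolding norm_on_Rn_def by blast
  have scale: "N (\<lambda>i. c * x i) = \<bar>c\<bar> * N x" if "x \<in> Rn n" for c x
    using N that unfolding norm_on_Rn_def by blast
  have triangle: "N (\<lambda>i. x i + y i) \<le> N x + N y" if "x \<in> Rn n" "y \<in> Rn n" for x y
    using N that unfolding norm_on_Rn_def by blast
  have "N (\<lambda>i. if i < k then v i else 0) \<le> (\<Sum>i<k. \<bar>v i\<bar> * N (?e i))" if "k \<le> n" for k
    using that
  proof (induction k)
    case 0
    show ?case
      by (simp add: zero topspace_Euclidean_space)
  next
    case (Suc k)
    have Rn: "(\<lambda>i. if i < k then v i else 0) \<in> Rn n" "(\<lambda>i. v k * ?e k i) \<in> Rn n" "?e k \<in> Rn n"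
      using Suc.prems by (auto simp: topspace_Euclidean_space)
    have "(\<lambda>i. if i < Suc k then v i else 0) = (\<lambda>i. (if i < k then v i else 0) + v k * ?e k i)"
      by (auto simp: less_Suc_eq)
    then have "N (\<lambda>i. if i < Suc k then v i else 0) \<le> N (\<lambda>i. if i < k then v i else 0) + N (\<lambda>i. v k * ?e k i)"
      using triangle[OF Rn(1,2)] by simp
    also have "N (\<lambda>i. v k * ?e k i) = \<bar>v k\<bar> * N (?e k)"
      by (rule scale[OF Rn(3)])
    finally show ?case
      using Suc by simp
  qed
  from this[of n] have "N (\<lambda>i. if i < n then v i else 0) \<le> (\<Sum>i<n. \<bar>v i\<bar> * N (?e i))"
    by simp
  moreover have "(\<lambda>i. if i < n then v i else 0) = v"
    using v by (auto simp: topspace_Euclidean_space)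
  ultimately show ?thesis
    by simp
qed

section \<open>Assembly of the approximating network\<close>

theorem mainTheorem6:
  fixes m n :: nat and \<sigma> :: "real \<Rightarrow> real" and \<alpha> \<delta> :: real and N :: "(nat \<Rightarrow> real) \<Rightarrow> real"
  assumes "0 < m" and "0 < n"
    and "\<exists>L. L-lipschitz_on UNIV \<sigma>"
    and "AE x in lebesgue. \<sigma> differentiable (at x)"
    and "0 < \<alpha>" and "\<alpha> \<le> 1"
    and "\<And>x. \<sigma> differentiable (at x) \<Longrightarrow> deriv \<sigma> x \<in> {\<alpha>..1}"
    and nonaffine: "\<not> (\<exists>a c. \<forall>s. \<sigma> s = a * s + c)"
    and "norm_on_Rn n N"
  shows "universal_approximator m n N (restricted_flow_nets \<sigma> \<delta> m n)"
proof -
  obtain L where L: "L-lipschitz_on UNIV \<sigma>"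
    using assms(3) by blast
  have growth: "\<alpha> * (y - x) \<le> \<sigma> y - \<sigma> x" if "x \<le> y" for x y
    using lipschitz_AE_deriv_ge[OF L assms(4) _ that, of \<alpha>] assms(7) by simp
  have mono: "\<alpha> * (x - y)\<^sup>2 \<le> (x - y) * (\<sigma> x - \<sigma> y)" for x y
  proof (cases "x \<le> y")
    case True
    have "(y - x) * (\<alpha> * (y - x)) \<le> (y - x) * (\<sigma> y - \<sigma> x)"
      by (rule mult_left_mono[OF growth[OF True]]) (use True in simp)
    then show ?thesis
      by (simp add: power2_eq_square algebra_simps)
  next
    case False
    have "(x - y) * (\<alpha> * (x - y)) \<le> (x - y) * (\<sigma> x - \<sigma> y)"
      by (rule mult_left_mono[OF growth]) (use False in auto)
    then show ?thesis
      by (simp add: power2_eq_square algebra_simps)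
  qed
  \<comment> \<open>The second argument forces
    \<open>exp (- \<alpha> * \<mu>) \<le> exp \<delta>\<close>; the first keeps the bound positive
    for every sign of \<open>\<delta>\<close>.\<close>
  have "0 < max 1 (- \<delta> / \<alpha>)"
    by simp
  then obtain \<mu> g s h where \<mu>: "max 1 (- \<delta> / \<alpha>) \<le> \<mu>"
    and ex: "\<And>x. \<exists>u. u 0 = x \<and> solves (\<lambda>x. \<sigma> (- \<mu> * x)) 1 u"
    and unique: "\<And>u. solves (\<lambda>x. \<sigma> (- \<mu> * x)) 1 u \<Longrightarrow> u 1 = g (u 0)"
    and g_lip: "\<And>x y. \<bar>g x - g y\<bar> \<le> exp (- \<alpha> * \<mu>) * \<bar>x - y\<bar>"
    and "g (s + 2 * h) - 2 * g (s + h) + g s \<noteq> 0"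
    by (rule nonaffine_time_one_map_exists[OF L mono nonaffine]) (rule that)
  then have g_nonaffine: "(fwd_diff h ^^ 2) g s \<noteq> 0"
    by (simp add: numeral_2_eq_2 fwd_diff_def algebra_simps)
  have "- \<delta> \<le> \<mu> * \<alpha>"
    using \<mu> pos_divide_le_eq[OF \<open>0 < \<alpha>\<close>, of "- \<delta>" \<mu>] by linarith
  then have contraction: "exp (- \<alpha> * \<mu>) \<le> exp \<delta>"
    by (simp add: mult.commute)
  define \<phi> where "\<phi> d = flow_map \<sigma> d (scalar_matrix (- \<mu>)) (\<lambda>_. 0)" for d
  have \<phi>: "\<phi> d u = (\<lambda>i. if i < d then g (u i) else 0)" if "u \<in> Rn d" for d u
    unfolding \<phi>_def using flow_map_scalar_matrix[OF ex unique that] .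
  have "Lip d (\<phi> d) \<le> ereal (exp (- \<alpha> * \<mu>))" for d
    by (rule Lip_componentwise_le[OF _ g_lip]) (simp add: \<phi>)
  then have \<phi>_Lip: "Lip d (\<phi> d) \<le> ereal (exp \<delta>)" for d
    by (rule order_trans) (use contraction in simp)
  define C where "C = (\<Sum>i<n. N (\<lambda>j. if j = i then 1 else 0))"
  have N_e: "0 \<le> N (\<lambda>j. if j = i then 1 else 0)" if "i < n" for i
    using \<open>norm_on_Rn n N\<close> that by (auto simp: norm_on_Rn_def topspace_Euclidean_space)
  then have "0 \<le> C"
    unfolding C_def by (intro sum_nonneg) simp
  show ?thesis
    unfolding universal_approximator_def
  proof (intro allI impI, elim conjE)
    fix f K and \<epsilon> :: real
    assume f: "continuous_map (Euclidean_space m) (Euclidean_space n) f"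
      and K: "compactin (Euclidean_space m) K" and "0 < \<epsilon>"
    \<comment> \<open>\<open>Euclidean_space m\<close> carries the subspace topology of the product
      topology, so compactness and continuity agree with those of the function type.\<close>
    have "compact K" and K_sub: "K \<subseteq> Rn m"
      using K by (auto simp: Euclidean_space_def compactin_subtopology euclidean_product_topology)
    have f_Rn: "f x \<in> Rn n" if "x \<in> K" for x
      using f K_sub that by (auto simp: continuous_map_def)
    have cont: "continuous_on K (\<lambda>x. f x i)" for i
    proof -
      have "continuous_on (Rn m) f"
        using f unfolding Euclidean_space_def
        by (simp add: continuous_map_in_subtopology euclidean_product_topology)
      then have "continuous_on K f"
        using K_sub continuous_on_subset by blast
      then show ?thesis
        by (rule continuous_on_product_then_coordinatewise)
    qed
    have mem: "(\<lambda>x. f x i) \<in> net_closure m g K" for i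
      by (rule continuous_mem_net_closure[OF g_lip g_nonaffine \<open>compact K\<close> _ cont])
        (use K_sub in \<open>auto simp: topspace_Euclidean_space\<close>)
    \<comment> \<open>With this tolerance in each coordinate, the sum weighted by the norms of the
      unit vectors is at most \<open>\<epsilon> / (C + 1) * C\<close>.\<close>
    have "0 < \<epsilon> / (C + 1)"
      using \<open>0 < \<epsilon>\<close> \<open>0 \<le> C\<close> by simp
    from net_closure_vector[of n "\<lambda>i x. f x i", OF mem this]
    obtain ys where "ys \<noteq> []" and ys: "\<And>x i. x \<in> K \<Longrightarrow>
        \<bar>(if i < n then f x i else 0) - (\<Sum>(c, w, b)\<leftarrow>ys. c i * g (dot m w x + b))\<bar> \<le> \<epsilon> / (C + 1)"
      by blast
    \<comment> \<open>Neuron \<open>k\<close> supplies row \<open>k\<close> and bias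
      \<open>k\<close> of \<open>l1\<close> and column \<open>k\<close> of \<open>l2\<close>; the
      flow in between applies \<open>g\<close> to every coordinate.\<close>
    define d where "d = length ys"
    define l1 where "l1 = affine_map m d (\<lambda>k. fst (snd (ys ! k))) (\<lambda>k. snd (snd (ys ! k)))"
    define l2 where "l2 = affine_map d n (\<lambda>i k. fst (ys ! k) i) (\<lambda>_. 0)"
    define \<psi> where "\<psi> = l2 \<circ> \<phi> d \<circ> l1"
    have "\<psi> \<in> restricted_flow_nets \<sigma> \<delta> m n"
    proof -
      have "l1 \<in> affine_maps m d" "l2 \<in> affine_maps d n" "\<phi> d \<in> flow_maps \<sigma> d"
        by (auto simp: l1_def l2_def \<phi>_def affine_maps_def flow_maps_def)
      moreover have "0 < d"
        using \<open>ys \<noteq> []\<close> by (simp add: d_def)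
      ultimately show ?thesis
        using \<phi>_Lip[of d] unfolding restricted_flow_nets_def \<psi>_def by blast
    qed
    moreover have "N (\<lambda>i. f x i - \<psi> x i) \<le> \<epsilon>" if "x \<in> K" for x
    proof -
      have "l1 x \<in> Rn d"
        by (simp add: l1_def affine_map_def topspace_Euclidean_space)
      then have \<psi>: "\<psi> x i = (if i < n then \<Sum>(c, w, b)\<leftarrow>ys. c i * g (dot m w x + b) else 0)" for i
        by (simp add: \<psi>_def l2_def affine_map_def \<phi> l1_def sum_list_sum_nth d_def dot_def
            case_prod_beta atLeast0LessThan)
      then have "(\<lambda>i. f x i - \<psi> x i) \<in> Rn n"
        using f_Rn[OF that] by (simp add: topspace_Euclidean_space)
      from norm_on_Rn_le_sum[OF \<open>norm_on_Rn n N\<close> this]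
      have "N (\<lambda>i. f x i - \<psi> x i) \<le> (\<Sum>i<n. \<bar>f x i - \<psi> x i\<bar> * N (\<lambda>j. if j = i then 1 else 0))" .
      also have "\<dots> \<le> (\<Sum>i<n. \<epsilon> / (C + 1) * N (\<lambda>j. if j = i then 1 else 0))"
      proof (intro sum_mono mult_right_mono)
        fix i assume "i \<in> {..<n}"
        then show "\<bar>f x i - \<psi> x i\<bar> \<le> \<epsilon> / (C + 1)"
          using ys[OF that, of i] by (simp add: \<psi>)
      qed (use N_e in auto)
      also have "\<dots> = \<epsilon> / (C + 1) * C"
        by (simp add: C_def sum_distrib_left)
      also have "\<dots> \<le> \<epsilon>"
        using \<open>0 < \<epsilon>\<close> \<open>0 \<le> C\<close> by (simp add: field_simps)
      finally show ?thesis .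
    qed
    ultimately show "\<exists>\<psi>\<in>restricted_flow_nets \<sigma> \<delta> m n. \<forall>x\<in>K. N (\<lambda>i. f x i - \<psi> x i) \<le> \<epsilon>"
      by blast
  qed
qed

end
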